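(* Let $K$ be a field, and let $\langle-,-\rangle:\mathcal{H}_{\mathcal{DP}}\otimes\mathcal{H}_{\mathcal{DP}}\longrightarrow K$ be the bilinear pairing defined on double posets by $\langle P,Q\rangle=\mathrm{Card}(S(P,Q))$. Then: 1. $\langle-,-\rangle$ is non-degenerate if, and only if, the characteristic of $K$ is zero. 2. The restriction $\langle-,-\rangle_{\mid\mathcal{H}_{\mathcal{PP}}}$ is non-degenerate. 3. The restriction $\langle-,-\rangle_{\mid\mathcal{H}_{\mathcal{WNP}}}$ is non-degenerate.
   Context: A double poset is a triple $(P,\leq_1,\leq_2)$ where $P$ is a finite set and $\leq_1,\leq_2$ are two partial orders on $P$; double posets are considered up to isomorphism. A plane poset is a double poset $(P,\leq_h,\leq_r)$ (with $\leq_h=\leq_1$, $\leq_r=\leq_2$) such that for all $x\neq y$ in $P$, $x$ and $y$ are comparable for $\leq_h$ if and only if they are not comparable for $\leq_r$. Let $N_1$ and $N_2$ be the following plane posets on $\{a,b,c,d\}$ (listing all strict relations): $N_1$: $a<_h c$, $a<_h d$, $b<_h d$; $a<_r b$, $c<_r b$, $c<_r d$. $N_2$: $a<_h c$, $b<_h c$, $b<_h d$; $a<_r b$, $a<_r d$, $c<_r d$. A double poset is WN if it is plane and has no subposet (subset with restricted orders) isomorphic to $N_1$ or $N_2$. $\mathcal{DP}$, $\mathcal{PP}$, $\mathcal{WNP}$ denote the sets of isomorphism classes of double posets, plane posets and WN posets, and $\mathcal{H}_{\mathcal{DP}}\supseteq\mathcal{H}_{\mathcal{PP}}\supseteq\mathcal{H}_{\mathcal{WNP}}$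 the $K$-vector spaces with these bases. For double posets $P,Q$, $S(P,Q)$ is the set of bijections $\sigma:P\longrightarrow Q$ such that for all $i,j\in P$: ($i\leq_1 j$ in $P$) implies ($\sigma(i)\leq_2\sigma(j)$ in $Q$), and ($\sigma(i)\leq_1\sigma(j)$ in $Q$) implies ($i\leq_2 j$ in $P$). The pairing is symmetric. A symmetric pairing on a vector space $H$ is non-degenerate if the only $x\in H$ with $\langle x,y\rangle=0$ for all $y\in H$ is $x=0$. *)

theory Defs
  imports
    Complex_Main
    "HOL-Library.FuncSet"
    "HOL-Library.Poly_Mapping"
    "HOL-Computational_Algebra.Computational_Algebra"
begin

text \<open>For plane posets, \<open>le1\<close> plays the role of \<open>\<le>\<^sub>h\<close> and \<open>le2\<close> that of \<open>\<le>\<^sub>r\<close>.\<close>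

record 'a double_poset =
  pts :: "'a set"
  le1 :: "'a rel"
  le2 :: "'a rel"

definition is_dposet :: "'a double_poset \<Rightarrow> bool" where
  "is_dposet P \<longleftrightarrow> finite (pts P) \<and> partial_order_on (pts P) (le1 P) \<and> partial_order_on (pts P) (le2 P)"

definition comparable :: "'a rel \<Rightarrow> 'a \<Rightarrow> 'a \<Rightarrow> bool" where
  "comparable r x y \<longleftrightarrow> (x, y) \<in> r \<or> (y, x) \<in> r"

definition is_plane :: "'a double_poset \<Rightarrow> bool" where
  "is_plane P \<longleftrightarrow> is_dposet P \<and>
     (\<forall>x\<in>pts P. \<forall>y\<in>pts P. x \<noteq> y \<longrightarrow> (comparable (le1 P) x y \<longleftrightarrow> \<not> comparable (le2 P) x y))"

definition dposet_iso :: "'a double_poset \<Rightarrow> 'b double_poset \<Rightarrow> bool" where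
  "dposet_iso P Q \<longleftrightarrow> (\<exists>f. bij_betw f (pts P) (pts Q) \<and>
     (\<forall>i\<in>pts P. \<forall>j\<in>pts P. (i, j) \<in> le1 P \<longleftrightarrow> (f i, f j) \<in> le1 Q) \<and>
     (\<forall>i\<in>pts P. \<forall>j\<in>pts P. (i, j) \<in> le2 P \<longleftrightarrow> (f i, f j) \<in> le2 Q))"

definition subposet :: "'a double_poset \<Rightarrow> 'a set \<Rightarrow> 'a double_poset" where
  "subposet P A = \<lparr>pts = A, le1 = le1 P \<inter> (A \<times> A), le2 = le2 P \<inter> (A \<times> A)\<rparr>"

text \<open>The points \<open>a, b, c, d\<close> are encoded as \<open>0, 1, 2, 3\<close>.\<close>

definition N1 :: "nat double_poset" where
  "N1 = \<lparr>pts = {0, 1, 2, 3},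
         le1 = Id_on {0, 1, 2, 3} \<union> {(0, 2), (0, 3), (1, 3)},
         le2 = Id_on {0, 1, 2, 3} \<union> {(0, 1), (2, 1), (2, 3)}\<rparr>"

definition N2 :: "nat double_poset" where
  "N2 = \<lparr>pts = {0, 1, 2, 3},
         le1 = Id_on {0, 1, 2, 3} \<union> {(0, 2), (1, 2), (1, 3)},
         le2 = Id_on {0, 1, 2, 3} \<union> {(0, 1), (0, 3), (2, 3)}\<rparr>"

lemma trans_iff_ball: "trans r \<longleftrightarrow> (\<forall>p\<in>r. \<forall>q\<in>r. snd p = fst q \<longrightarrow> (fst p, snd q) \<in> r)"
  by (force simp: trans_def)

lemma antisym_iff_ball: "antisym r \<longleftrightarrow> (\<forall>p\<in>r. (snd p, fst p) \<in> r \<longrightarrow> fst p = snd p)"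
  by (force simp: antisym_def)

lemma is_plane_N1: "is_plane N1"
  by (simp add: N1_def is_plane_def is_dposet_def comparable_def order_on_defs
      refl_on_def trans_iff_ball antisym_iff_ball Id_on_def)

lemma is_plane_N2: "is_plane N2"
  by (simp add: N2_def is_plane_def is_dposet_def comparable_def order_on_defs
      refl_on_def trans_iff_ball antisym_iff_ball Id_on_def)

definition is_WN :: "'a double_poset \<Rightarrow> bool" where
  "is_WN P \<longleftrightarrow> is_plane P \<and>
     (\<forall>A\<subseteq>pts P. \<not> dposet_iso (subposet P A) N1 \<and> \<not> dposet_iso (subposet P A) N2)"

text \<open>Functions are taken extensional, so that \<open>S P Q\<close> contains one function for each bijection
  from \<open>pts P\<close> to \<open>pts Q\<close> and its cardinality is the intended one.\<close>

definition S :: "'a double_poset \<Rightarrow> 'b double_poset \<Rightarrow> ('a \<Rightarrow> 'b) set" where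
  "S P Q = {\<sigma> \<in> extensional (pts P). bij_betw \<sigma> (pts P) (pts Q) \<and>
     (\<forall>i\<in>pts P. \<forall>j\<in>pts P.
        ((i, j) \<in> le1 P \<longrightarrow> (\<sigma> i, \<sigma> j) \<in> le2 Q) \<and>
        ((\<sigma> i, \<sigma> j) \<in> le1 Q \<longrightarrow> (i, j) \<in> le2 P))}"

lemma dposet_iso_refl: "dposet_iso P P"
  unfolding dposet_iso_def by (rule exI[of _ id]) auto

lemma dposet_iso_sym:
  assumes "dposet_iso P Q"
  shows "dposet_iso Q P"
proof -
  from assms obtain f where f: "bij_betw f (pts P) (pts Q)"
    and l1: "\<forall>i\<in>pts P. \<forall>j\<in>pts P. (i, j) \<in> le1 P \<longleftrightarrow> (f i, f j) \<in> le1 Q"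
    and l2: "\<forall>i\<in>pts P. \<forall>j\<in>pts P. (i, j) \<in> le2 P \<longleftrightarrow> (f i, f j) \<in> le2 Q"
    unfolding dposet_iso_def by blast
  let ?g = "inv_into (pts P) f"
  have g: "bij_betw ?g (pts Q) (pts P)" by (rule bij_betw_inv_into[OF f])
  have "?g i \<in> pts P" "f (?g i) = i" if "i \<in> pts Q" for i
    using bij_betw_apply[OF g that] bij_betw_inv_into_right[OF f that] by auto
  with g l1 l2 show ?thesis
    unfolding dposet_iso_def by (intro exI[of _ ?g]) simp
qed

lemma dposet_iso_trans:
  assumes "dposet_iso P Q" "dposet_iso Q R"
  shows "dposet_iso P R"
proof -
  from assms(1) obtain f where f: "bij_betw f (pts P) (pts Q)"
    "\<forall>i\<in>pts P. \<forall>j\<in>pts P. (i, j) \<in> le1 P \<longleftrightarrow> (f i, f j) \<in> le1 Q"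
    "\<forall>i\<in>pts P. \<forall>j\<in>pts P. (i, j) \<in> le2 P \<longleftrightarrow> (f i, f j) \<in> le2 Q"
    unfolding dposet_iso_def by blast
  from assms(2) obtain g where g: "bij_betw g (pts Q) (pts R)"
    "\<forall>i\<in>pts Q. \<forall>j\<in>pts Q. (i, j) \<in> le1 Q \<longleftrightarrow> (g i, g j) \<in> le1 R"
    "\<forall>i\<in>pts Q. \<forall>j\<in>pts Q. (i, j) \<in> le2 Q \<longleftrightarrow> (g i, g j) \<in> le2 R"
    unfolding dposet_iso_def by blast
  have "f i \<in> pts Q" if "i \<in> pts P" for i using bij_betw_apply[OF f(1) that] .
  with f g bij_betw_trans[OF f(1) g(1)] show ?thesis
    unfolding dposet_iso_def by (intro exI[of _ "g \<circ> f"]) simp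
qed

lemma finite_S:
  assumes "finite (pts P)" "finite (pts Q)"
  shows "finite (S P Q)"
proof (rule finite_subset)
  show "S P Q \<subseteq> pts P \<rightarrow>\<^sub>E pts Q"
    by (auto simp: S_def PiE_def bij_betw_def)
  show "finite (pts P \<rightarrow>\<^sub>E pts Q)"
    using assms by (simp add: finite_PiE)
qed

lemma card_S_le:
  assumes "finite (pts P')" "finite (pts Q')" "dposet_iso P P'" "dposet_iso Q Q'"
  shows "card (S P Q) \<le> card (S P' Q')"
proof -
  from dposet_iso_sym[OF assms(3)] obtain f where f: "bij_betw f (pts P') (pts P)"
    "\<forall>i\<in>pts P'. \<forall>j\<in>pts P'. (i, j) \<in> le1 P' \<longleftrightarrow> (f i, f j) \<in> le1 P"
    "\<forall>i\<in>pts P'. \<forall>j\<in>pts P'. (i, j) \<in> le2 P' \<longleftrightarrow> (f i, f j) \<in> le2 P"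
    unfolding dposet_iso_def by blast
  from assms(4) obtain g where g: "bij_betw g (pts Q) (pts Q')"
    "\<forall>i\<in>pts Q. \<forall>j\<in>pts Q. (i, j) \<in> le1 Q \<longleftrightarrow> (g i, g j) \<in> le1 Q'"
    "\<forall>i\<in>pts Q. \<forall>j\<in>pts Q. (i, j) \<in> le2 Q \<longleftrightarrow> (g i, g j) \<in> le2 Q'"
    unfolding dposet_iso_def by blast
  let ?h = "\<lambda>\<sigma>. restrict (g \<circ> \<sigma> \<circ> f) (pts P')"
  have fP: "f i \<in> pts P" if "i \<in> pts P'" for i using bij_betw_apply[OF f(1) that] .
  have "inj_on ?h (S P Q)"
  proof (rule inj_onI)
    fix \<sigma> \<tau> assume st: "\<sigma> \<in> S P Q" "\<tau> \<in> S P Q" and eq: "?h \<sigma> = ?h \<tau>"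
    have "\<sigma> x = \<tau> x" if x: "x \<in> pts P" for x
    proof -
      obtain y where y: "y \<in> pts P'" "x = f y"
        using f(1) x by (auto simp: bij_betw_def)
      have "g (\<sigma> x) = g (\<tau> x)" using fun_cong[OF eq, of y] y by simp
      moreover have "\<sigma> x \<in> pts Q" "\<tau> x \<in> pts Q"
        using st x by (auto simp: S_def bij_betw_def)
      ultimately show ?thesis using g(1) by (auto simp: bij_betw_def dest: inj_onD)
    qed
    then show "\<sigma> = \<tau>"
      using st by (auto simp: S_def intro: extensionalityI)
  qed
  moreover have "?h ` S P Q \<subseteq> S P' Q'"
  proof (rule image_subsetI)
    fix \<sigma> assume s: "\<sigma> \<in> S P Q"
    have b: "bij_betw \<sigma> (pts P) (pts Q)" using s by (simp add: S_def)
    have "bij_betw (g \<circ> \<sigma> \<circ> f) (pts P') (pts Q')"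
      using bij_betw_trans[OF f(1) bij_betw_trans[OF b g(1)]] by (simp add: comp_assoc)
    then have "bij_betw (?h \<sigma>) (pts P') (pts Q')"
      by (subst bij_betw_cong[of _ _ "g \<circ> \<sigma> \<circ> f"]) auto
    moreover have "\<sigma> x \<in> pts Q" if "x \<in> pts P" for x using bij_betw_apply[OF b that] .
    ultimately show "?h \<sigma> \<in> S P' Q'"
      using f(2,3) g(2,3) s fP by (simp add: S_def)
  qed
  ultimately show ?thesis
    using finite_S[OF assms(1,2)] by (rule card_inj_on_le)
qed

lemma dposet_iso_is_plane:
  assumes "dposet_iso P Q" "is_plane P" "is_dposet Q"
  shows "is_plane Q"
proof -
  from dposet_iso_sym[OF assms(1)] obtain f where f: "bij_betw f (pts Q) (pts P)"
    "\<forall>i\<in>pts Q. \<forall>j\<in>pts Q. (i, j) \<in> le1 Q \<longleftrightarrow> (f i, f j) \<in> le1 P"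
    "\<forall>i\<in>pts Q. \<forall>j\<in>pts Q. (i, j) \<in> le2 Q \<longleftrightarrow> (f i, f j) \<in> le2 P"
    unfolding dposet_iso_def by blast
  have "f i \<in> pts P" if "i \<in> pts Q" for i using bij_betw_apply[OF f(1) that] .
  moreover have "f i \<noteq> f j" if "i \<in> pts Q" "j \<in> pts Q" "i \<noteq> j" for i j
    using f(1) that by (auto simp: bij_betw_def dest: inj_onD)
  ultimately show ?thesis
    using f(2,3) assms(2,3) unfolding is_plane_def comparable_def by simp
qed

lemma dposet_iso_subposet:
  assumes "dposet_iso P Q" "B \<subseteq> pts Q"
  shows "\<exists>A\<subseteq>pts P. dposet_iso (subposet P A) (subposet Q B)"
proof -
  from dposet_iso_sym[OF assms(1)] obtain f where f: "bij_betw f (pts Q) (pts P)"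
    "\<forall>i\<in>pts Q. \<forall>j\<in>pts Q. (i, j) \<in> le1 Q \<longleftrightarrow> (f i, f j) \<in> le1 P"
    "\<forall>i\<in>pts Q. \<forall>j\<in>pts Q. (i, j) \<in> le2 Q \<longleftrightarrow> (f i, f j) \<in> le2 P"
    unfolding dposet_iso_def by blast
  have "bij_betw f B (f ` B)"
    using f(1) assms(2) by (meson bij_betw_subset)
  then have "dposet_iso (subposet Q B) (subposet P (f ` B))"
    using f(2,3) assms(2) unfolding dposet_iso_def subposet_def
    by (intro exI[of _ f]) (auto simp: subset_iff)
  moreover have "f ` B \<subseteq> pts P" using f(1) assms(2) by (auto simp: bij_betw_def)
  ultimately show ?thesis using dposet_iso_sym by blast
qed

lemma dposet_iso_is_WN:
  assumes "dposet_iso P Q" "is_WN P" "is_dposet Q"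
  shows "is_WN Q"
proof -
  have "is_plane Q"
    using assms dposet_iso_is_plane unfolding is_WN_def by blast
  moreover have "\<not> dposet_iso (subposet Q B) N1 \<and> \<not> dposet_iso (subposet Q B) N2"
    if "B \<subseteq> pts Q" for B
    using dposet_iso_subposet[OF assms(1) that] assms(2) dposet_iso_trans
    unfolding is_WN_def by blast
  ultimately show ?thesis unfolding is_WN_def by blast
qed

lemma map_prod_image_mem:
  assumes "inj_on f A" "r \<subseteq> A \<times> A" "i \<in> A" "j \<in> A"
  shows "(f i, f j) \<in> map_prod f f ` r \<longleftrightarrow> (i, j) \<in> r"
proof
  assume "(f i, f j) \<in> map_prod f f ` r"
  then obtain a b where ab: "(a, b) \<in> r" "f i = f a" "f j = f b" by auto
  with assms have "i = a" "j = b" by (auto dest: inj_onD)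
  with ab show "(i, j) \<in> r" by simp
qed (auto intro: rev_image_eqI)

lemma partial_order_on_map_prod:
  assumes f: "inj_on f A" and r: "partial_order_on A r"
  shows "partial_order_on (f ` A) (map_prod f f ` r)"
proof -
  let ?r = "map_prod f f ` r"
  have sub: "r \<subseteq> A \<times> A" using r by (rule partial_order_onD(4))
  have sub': "?r \<subseteq> f ` A \<times> f ` A" using sub by auto
  note mem = map_prod_image_mem[OF f sub]
  have "refl_on (f ` A) ?r"
    using partial_order_onD(1)[OF r] mem by (simp add: refl_on_def)
  moreover have "trans ?r"
  proof (rule transI)
    fix x y z assume xy: "(x, y) \<in> ?r" and yz: "(y, z) \<in> ?r"
    have "x \<in> f ` A" "y \<in> f ` A" "z \<in> f ` A" using xy yz sub' by auto
    then obtain a b c where abc: "a \<in> A" "b \<in> A" "c \<in> A" "x = f a" "y = f b" "z = f c"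
      by (elim imageE)
    then have "(a, b) \<in> r" "(b, c) \<in> r" using xy yz mem by simp_all
    then have "(a, c) \<in> r" by (rule transD[OF partial_order_onD(2)[OF r]])
    then show "(x, z) \<in> ?r" using abc mem by simp
  qed
  moreover have "antisym ?r"
  proof (rule antisymI)
    fix x y assume xy: "(x, y) \<in> ?r" and yx: "(y, x) \<in> ?r"
    have "x \<in> f ` A" "y \<in> f ` A" using xy sub' by auto
    then obtain a b where ab: "a \<in> A" "b \<in> A" "x = f a" "y = f b"
      by (elim imageE)
    then have "(a, b) \<in> r" "(b, a) \<in> r" using xy yx mem by simp_all
    then have "a = b" by (rule antisymD[OF partial_order_onD(3)[OF r]])
    then show "x = y" using ab by simp
  qed
  ultimately show ?thesis using sub' by (simp add: order_on_defs)
qed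

text \<open>Restricting to carriers inside \<open>nat\<close> loses no isomorphism class.\<close>

lemma dposet_iso_nat:
  fixes P :: "'a double_poset"
  assumes "is_dposet P"
  shows "\<exists>Q :: nat double_poset. is_dposet Q \<and> dposet_iso P Q"
proof -
  have fin: "finite (pts P)" and r1: "partial_order_on (pts P) (le1 P)"
    and r2: "partial_order_on (pts P) (le2 P)"
    using assms by (simp_all add: is_dposet_def)
  obtain f :: "'a \<Rightarrow> nat" where f: "inj_on f (pts P)"
    using finite_imp_inj_to_nat_seg[OF fin] by blast
  define Q where "Q = \<lparr>pts = f ` pts P, le1 = map_prod f f ` le1 P, le2 = map_prod f f ` le2 P\<rparr>"
  have "is_dposet Q"
    using fin partial_order_on_map_prod[OF f r1] partial_order_on_map_prod[OF f r2]
    by (simp add: is_dposet_def Q_def)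
  moreover have "dposet_iso P Q"
    using map_prod_image_mem[OF f partial_order_onD(4)[OF r1]]
      map_prod_image_mem[OF f partial_order_onD(4)[OF r2]] f
    unfolding dposet_iso_def Q_def by (intro exI[of _ f]) (simp add: bij_betw_def)
  ultimately show ?thesis by blast
qed

quotient_type dpclass = "nat double_poset" / partial:
  "\<lambda>P Q. is_dposet P \<and> is_dposet Q \<and> dposet_iso P Q"
proof (rule part_equivpI)
  show "\<exists>P :: nat double_poset. is_dposet P \<and> is_dposet P \<and> dposet_iso P P"
    by (rule exI[of _ N1]) (use is_plane_N1 dposet_iso_refl in \<open>auto simp: is_plane_def\<close>)
  show "symp (\<lambda>P Q :: nat double_poset. is_dposet P \<and> is_dposet Q \<and> dposet_iso P Q)"
    by (auto intro!: sympI dposet_iso_sym)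
  show "transp (\<lambda>P Q :: nat double_poset. is_dposet P \<and> is_dposet Q \<and> dposet_iso P Q)"
    by (auto intro!: transpI intro: dposet_iso_trans)
qed

lift_definition card_S :: "dpclass \<Rightarrow> dpclass \<Rightarrow> nat" is "\<lambda>P Q. card (S P Q)"
  by (intro antisym card_S_le) (auto simp: is_dposet_def dposet_iso_sym)

lift_definition plane_class :: "dpclass \<Rightarrow> bool" is is_plane
  using dposet_iso_is_plane dposet_iso_sym by blast

lift_definition WN_class :: "dpclass \<Rightarrow> bool" is is_WN
  using dposet_iso_is_WN dposet_iso_sym by blast

definition DP :: "dpclass set" where "DP = UNIV"
definition PP :: "dpclass set" where "PP = {p. plane_class p}"
definition WNP :: "dpclass set" where "WNP = {p. WN_class p}"

text \<open>The vector space with basis \<open>B\<close>, as a subspace of the space of all finitely supported functions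
  on the isomorphism classes.\<close>

definition H :: "dpclass set \<Rightarrow> (dpclass \<Rightarrow>\<^sub>0 'k::field) set" where
  "H B = {x. Poly_Mapping.keys x \<subseteq> B}"

definition pairing :: "(dpclass \<Rightarrow>\<^sub>0 'k::field) \<Rightarrow> (dpclass \<Rightarrow>\<^sub>0 'k) \<Rightarrow> 'k" where
  "pairing x y = (\<Sum>p\<in>Poly_Mapping.keys x. \<Sum>q\<in>Poly_Mapping.keys y.
     Poly_Mapping.lookup x p * Poly_Mapping.lookup y q * of_nat (card_S p q))"

lemma pairing_single:
  "pairing (Poly_Mapping.single p 1) (Poly_Mapping.single q 1) = (of_nat (card_S p q) :: 'k::field)"
  by (simp add: pairing_def)

text \<open>Non-degeneracy of the restriction to \<open>V\<close> of a symmetric pairing.\<close>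

definition nondegenerate_on :: "('v::zero) set \<Rightarrow> ('v \<Rightarrow> 'v \<Rightarrow> 'k::zero) \<Rightarrow> bool" where
  "nondegenerate_on V b \<longleftrightarrow> (\<forall>x\<in>V. (\<forall>y\<in>V. b x y = 0) \<longrightarrow> x = 0)"

end

theory Submission
  imports Defs
begin

text \<open>
  Twisting the second argument of the pairing by \<open>swap_orders\<close>, the exchange of the two orders, makes
  its matrix triangular. Indeed \<open>S P (swap_orders Q)\<close> consists of the bijections that carry \<open>le1 P\<close>
  into \<open>le1 Q\<close> and whose inverses carry \<open>le2 Q\<close> into \<open>le2 P\<close>. Such a bijection can only enlarge the
  first order and shrink the second, so it does not decrease the integer
  \<open>order_excess P = |le1 P| - |le2 P|\<close>, and it is an isomorphism as soon as this integer is
  unchanged. Hence the entry at \<open>(P, swap_orders Q)\<close> vanishes unless \<open>P\<close> and \<open>Q\<close> are isomorphic or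
  \<open>P\<close> has strictly smaller excess than \<open>Q\<close> (\<open>S_swap_orders_iso_or_excess_less\<close>), and the diagonal
  entry at \<open>(P, swap_orders P)\<close> is the number of automorphisms of \<open>P\<close>.

  Consequently the restriction to the span of a family of classes is nondegenerate whenever the family
  is stable under \<open>swap_orders\<close> and no automorphism number of its members vanishes in the field:
  for \<open>x \<noteq> 0\<close> choose \<open>p\<close> of least excess in the support of \<open>x\<close>, and pair \<open>x\<close> with the swap of \<open>p\<close>
  (\<open>nondegenerate_on_H\<close>).

  In characteristic zero the automorphism numbers of all double posets are nonzero. In a plane poset
  the union of the two orders is a total order, and it is preserved by automorphisms; a finite
  totally ordered set has no automorphism but the identity, so the diagonal entries are \<open>1\<close> in every
  field (\<open>card_S_swap_orders_plane\<close>). Plane posets are stable under the swap, and so are WN posets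
  because the swap exchanges \<open>N1\<close> and \<open>N2\<close> up to isomorphism.

  Conversely, let both orders on \<open>n\<close> points be trivial. A bijection from this double poset to \<open>Q\<close>
  belongs to \<open>S\<close> exactly if the first order of \<open>Q\<close> is trivial, so the pairing of the two is \<open>0\<close> or
  \<open>n!\<close>. When \<open>n\<close> is the positive characteristic, this basis vector is orthogonal to the whole space.
\<close>

section \<open>Exchanging the two orders\<close>

definition swap_orders :: "'a double_poset \<Rightarrow> 'a double_poset" where
  "swap_orders P = \<lparr>pts = pts P, le1 = le2 P, le2 = le1 P\<rparr>"

lemma swap_orders_simps [simp]:
  "pts (swap_orders P) = pts P" "le1 (swap_orders P) = le2 P" "le2 (swap_orders P) = le1 P"
  by (simp_all add: swap_orders_def)

lemma swap_orders_swap_orders [simp]: "swap_orders (swap_orders P) = (P :: 'a double_poset)"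
  by (simp add: swap_orders_def)

lemma is_dposet_swap_orders: "is_dposet P \<Longrightarrow> is_dposet (swap_orders P)"
  by (simp add: is_dposet_def)

lemma dposet_iso_swap_orders: "dposet_iso P Q \<Longrightarrow> dposet_iso (swap_orders P) (swap_orders Q)"
  unfolding dposet_iso_def by auto

lemma is_plane_swap_orders: "is_plane P \<Longrightarrow> is_plane (swap_orders P)"
  unfolding is_plane_def swap_orders_simps using is_dposet_swap_orders by blast

lemma subposet_swap_orders: "subposet (swap_orders P) A = swap_orders (subposet P A)"
  by (simp add: subposet_def swap_orders_def)

text \<open>The isomorphism fixes \<open>a\<close> and \<open>d\<close> and exchanges \<open>b\<close> and \<open>c\<close>.\<close>

lemma dposet_iso_swap_orders_N1: "dposet_iso (swap_orders N1) N2"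
  unfolding dposet_iso_def N1_def N2_def swap_orders_def
  by (rule exI[of _ "id(1 := 2, 2 := 1)"]) (simp add: bij_betw_def inj_on_def Id_on_def, blast)

lemma dposet_iso_swap_orders_N2: "dposet_iso (swap_orders N2) N1"
  using dposet_iso_swap_orders[OF dposet_iso_sym[OF dposet_iso_swap_orders_N1]] by simp

lemma is_WN_swap_orders:
  assumes "is_WN P"
  shows "is_WN (swap_orders P)"
proof -
  have "\<not> dposet_iso (subposet (swap_orders P) A) N1 \<and>
        \<not> dposet_iso (subposet (swap_orders P) A) N2" if "A \<subseteq> pts P" for A
  proof -
    have "dposet_iso (subposet P A) N2" if "dposet_iso (swap_orders (subposet P A)) N1"
      using dposet_iso_trans[OF dposet_iso_swap_orders[OF that] dposet_iso_swap_orders_N1] by simp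
    moreover have "dposet_iso (subposet P A) N1" if "dposet_iso (swap_orders (subposet P A)) N2"
      using dposet_iso_trans[OF dposet_iso_swap_orders[OF that] dposet_iso_swap_orders_N2] by simp
    ultimately show ?thesis
      using assms \<open>A \<subseteq> pts P\<close> unfolding is_WN_def subposet_swap_orders by blast
  qed
  then show ?thesis
    using assms is_plane_swap_orders unfolding is_WN_def by auto
qed

section \<open>Triangularity of the twisted pairing\<close>

text \<open>The grading along which the twisted pairing is triangular.\<close>

definition order_excess :: "'a double_poset \<Rightarrow> int" where
  "order_excess P = int (card (le1 P)) - int (card (le2 P))"

lemma is_dposetD:
  assumes "is_dposet P"
  shows "finite (pts P)" "le1 P \<subseteq> pts P \<times> pts P" "le2 P \<subseteq> pts P \<times> pts P"
    "finite (le1 P)" "finite (le2 P)"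
proof -
  show fin: "finite (pts P)" and s: "le1 P \<subseteq> pts P \<times> pts P" "le2 P \<subseteq> pts P \<times> pts P"
    using assms partial_order_onD(4) by (auto simp: is_dposet_def)
  show "finite (le1 P)" "finite (le2 P)"
    using s fin by (meson finite_SigmaI finite_subset)+
qed

text \<open>
  The bijection \<open>\<sigma>\<close> embeds \<open>le1 P\<close> into \<open>le1 Q\<close>, and the image of \<open>le2 P\<close> contains \<open>le2 Q\<close>. Both
  inclusions push the excess up; if it does not grow, they are inclusions between finite sets of equal
  size, hence equalities.
\<close>

lemma S_swap_orders_excess:
  assumes P: "is_dposet P" and Q: "is_dposet Q" and s: "\<sigma> \<in> S P (swap_orders Q)"
  shows "order_excess P \<le> order_excess Q"
    and "order_excess Q \<le> order_excess P \<Longrightarrow> i \<in> pts P \<Longrightarrow> j \<in> pts P \<Longrightarrow>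
           ((i, j) \<in> le1 P \<longleftrightarrow> (\<sigma> i, \<sigma> j) \<in> le1 Q) \<and> ((i, j) \<in> le2 P \<longleftrightarrow> (\<sigma> i, \<sigma> j) \<in> le2 Q)"
proof -
  let ?f = "map_prod \<sigma> \<sigma>"
  note dP = is_dposetD[OF P] and dQ = is_dposetD[OF Q]
  have inj: "inj_on \<sigma> (pts P)" and im: "\<sigma> ` pts P = pts Q"
    using s by (auto simp: S_def bij_betw_def)
  have "inj_on ?f (pts P \<times> pts P)"
    using inj by (rule map_prod_inj_on[OF _ inj])
  then have c: "card (?f ` le1 P) = card (le1 P)" "card (?f ` le2 P) = card (le2 P)"
    using dP by (meson card_image inj_on_subset)+
  have sub1: "?f ` le1 P \<subseteq> le1 Q"
    using s dP(2) by (auto simp: S_def)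
  have sub2: "le2 Q \<subseteq> ?f ` le2 P"
  proof (rule subrelI)
    fix x y assume xy: "(x, y) \<in> le2 Q"
    then have "x \<in> \<sigma> ` pts P" "y \<in> \<sigma> ` pts P" using dQ(3) im by auto
    then obtain i j where "i \<in> pts P" "j \<in> pts P" "x = \<sigma> i" "y = \<sigma> j" by (elim imageE)
    then show "(x, y) \<in> ?f ` le2 P"
      using s xy by (force simp: S_def)
  qed
  have le: "card (le1 P) \<le> card (le1 Q)" "card (le2 Q) \<le> card (le2 P)"
    using card_mono[OF dQ(4) sub1] card_mono[OF finite_imageI[OF dP(5)] sub2] c by simp_all
  then show "order_excess P \<le> order_excess Q" by (simp add: order_excess_def)
  assume "order_excess Q \<le> order_excess P" and ij: "i \<in> pts P" "j \<in> pts P"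
  with le have "card (le1 Q) = card (?f ` le1 P)" "card (?f ` le2 P) = card (le2 Q)"
    using c by (simp_all add: order_excess_def)
  then have "?f ` le1 P = le1 Q" "?f ` le2 P = le2 Q"
    using card_subset_eq[OF dQ(4) sub1] card_subset_eq[OF finite_imageI[OF dP(5)] sub2] by simp_all
  then show "((i, j) \<in> le1 P \<longleftrightarrow> (\<sigma> i, \<sigma> j) \<in> le1 Q) \<and> ((i, j) \<in> le2 P \<longleftrightarrow> (\<sigma> i, \<sigma> j) \<in> le2 Q)"
    using map_prod_image_mem[OF inj dP(2) ij] map_prod_image_mem[OF inj dP(3) ij] by simp
qed

lemma S_swap_orders_iso_or_excess_less:
  assumes P: "is_dposet P" and Q: "is_dposet Q" and "S P (swap_orders Q) \<noteq> {}"
  shows "dposet_iso P Q \<or> order_excess P < order_excess Q"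
proof -
  obtain \<sigma> where s: "\<sigma> \<in> S P (swap_orders Q)" using assms(3) by blast
  note e = S_swap_orders_excess[OF P Q s]
  have "dposet_iso P Q" if "order_excess Q \<le> order_excess P"
    using e(2)[OF that] s unfolding dposet_iso_def S_def by auto
  then show ?thesis by linarith
qed

lemma dposet_iso_imp_S_swap_orders:
  assumes "dposet_iso P Q"
  shows "S P (swap_orders Q) \<noteq> {}"
proof -
  obtain f where f: "bij_betw f (pts P) (pts Q)"
    "\<forall>i\<in>pts P. \<forall>j\<in>pts P. (i, j) \<in> le1 P \<longleftrightarrow> (f i, f j) \<in> le1 Q"
    "\<forall>i\<in>pts P. \<forall>j\<in>pts P. (i, j) \<in> le2 P \<longleftrightarrow> (f i, f j) \<in> le2 Q"
    using assms unfolding dposet_iso_def by blast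
  have "bij_betw (restrict f (pts P)) (pts P) (pts Q)"
    using f(1) by (subst bij_betw_cong[of _ _ f]) auto
  then have "restrict f (pts P) \<in> S P (swap_orders Q)"
    using f by (simp add: S_def)
  then show ?thesis by blast
qed

lemma order_excess_iso:
  assumes "is_dposet P" "is_dposet Q" "dposet_iso P Q"
  shows "order_excess P = order_excess Q"
  using S_swap_orders_excess(1)[OF assms(1,2)] S_swap_orders_excess(1)[OF assms(2,1)]
    dposet_iso_imp_S_swap_orders[OF assms(3)]
    dposet_iso_imp_S_swap_orders[OF dposet_iso_sym[OF assms(3)]]
  by (meson antisym ex_in_conv)

lemma card_S_swap_orders_self_pos:
  assumes "is_dposet P"
  shows "card (S P (swap_orders P)) > 0"
  using dposet_iso_imp_S_swap_orders[OF dposet_iso_refl, of P] finite_S[of P "swap_orders P"]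
    is_dposetD(1)[OF assms]
  by (simp add: card_gt_0_iff)

section \<open>Rigidity of plane posets\<close>

text \<open>
  If \<open>z\<close> were below \<open>x\<close> in one of the relations, transitivity of that relation would make \<open>x, y\<close> or
  \<open>y, z\<close> comparable in both; as \<open>x\<close> and \<open>z\<close> must be comparable in one of them, \<open>x\<close> is below \<open>z\<close>.
\<close>

lemma complementary_orders_compose:
  assumes "trans r" "trans s"
    and compl: "\<And>u v. u \<in> A \<Longrightarrow> v \<in> A \<Longrightarrow> u \<noteq> v \<Longrightarrow>
      comparable r u v \<longleftrightarrow> \<not> comparable s u v"
    and A: "x \<in> A" "y \<in> A" "z \<in> A" and xy: "(x, y) \<in> r" and yz: "(y, z) \<in> s"
  shows "(x, z) \<in> r \<union> s"
proof (cases "x = y \<or> y = z")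
  case False
  have n: "(y, x) \<notin> s" "(z, y) \<notin> r"
    using compl[of x y] compl[of y z] A xy yz False unfolding comparable_def by auto
  have "x \<noteq> z" using n yz by blast
  moreover have "(z, x) \<notin> r" using n(2) xy \<open>trans r\<close> by (meson transD)
  moreover have "(z, x) \<notin> s" using n(1) yz \<open>trans s\<close> by (meson transD)
  ultimately show ?thesis
    using compl[of x z] A unfolding comparable_def by auto
qed (use xy yz in auto)

lemma plane_total_order_trans:
  assumes P: "is_plane P"
    and xy: "(x, y) \<in> le1 P \<union> le2 P" and yz: "(y, z) \<in> le1 P \<union> le2 P"
  shows "(x, z) \<in> le1 P \<union> le2 P"
proof -
  have r: "partial_order_on (pts P) (le1 P)" "partial_order_on (pts P) (le2 P)"
    using P by (simp_all add: is_plane_def is_dposet_def)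
  note t = partial_order_onD(2)[OF r(1)] partial_order_onD(2)[OF r(2)]
  have pts: "x \<in> pts P" "y \<in> pts P" "z \<in> pts P"
    using xy yz partial_order_onD(4)[OF r(1)] partial_order_onD(4)[OF r(2)] by auto
  have c: "comparable (le1 P) u v \<longleftrightarrow> \<not> comparable (le2 P) u v"
    if "u \<in> pts P" "v \<in> pts P" "u \<noteq> v" for u v
    using P that unfolding is_plane_def by blast
  then have c': "comparable (le2 P) u v \<longleftrightarrow> \<not> comparable (le1 P) u v"
    if "u \<in> pts P" "v \<in> pts P" "u \<noteq> v" for u v
    using that by blast
  consider "(x, y) \<in> le1 P" "(y, z) \<in> le1 P" | "(x, y) \<in> le2 P" "(y, z) \<in> le2 P"
    | "(x, y) \<in> le1 P" "(y, z) \<in> le2 P" | "(x, y) \<in> le2 P" "(y, z) \<in> le1 P"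
    using xy yz by blast
  then show ?thesis
  proof cases
    case 1
    then show ?thesis using t(1) by (meson UnI1 transD)
  next
    case 2
    then show ?thesis using t(2) by (meson UnI2 transD)
  next
    case 3
    then show ?thesis using complementary_orders_compose[OF t c pts] by blast
  next
    case 4
    then show ?thesis using complementary_orders_compose[OF t(2,1) c' pts] by blast
  qed
qed

text \<open>
  An automorphism preserves the number of predecessors of a point in the total order that is the union
  of the two orders, and this number determines the point.
\<close>

lemma plane_automorphism_trivial:
  assumes P: "is_plane P" and s: "\<sigma> \<in> S P (swap_orders P)" and x: "x \<in> pts P"
  shows "\<sigma> x = x"
proof -
  have d: "is_dposet P" using P by (simp add: is_plane_def)
  note fin = is_dposetD(1)[OF d]
  have r: "partial_order_on (pts P) (le1 P)" "partial_order_on (pts P) (le2 P)"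
    using d by (simp_all add: is_dposet_def)
  let ?T = "le1 P \<union> le2 P"
  define rank where "rank u = card {v \<in> pts P. (v, u) \<in> ?T}" for u
  have b: "bij_betw \<sigma> (pts P) (pts P)" using s by (simp add: S_def)
  have pres: "(\<sigma> u, \<sigma> v) \<in> ?T \<longleftrightarrow> (u, v) \<in> ?T" if "u \<in> pts P" "v \<in> pts P" for u v
    using S_swap_orders_excess(2)[OF d d s _ that] by blast
  have rank_less: "rank u < rank v" if "u \<in> pts P" "v \<in> pts P" "u \<noteq> v" "(u, v) \<in> ?T" for u v
  proof -
    have "(v, u) \<notin> ?T"
      using P that partial_order_onD(3)[OF r(1), THEN antisymD]
        partial_order_onD(3)[OF r(2), THEN antisymD]
      unfolding is_plane_def comparable_def by blast
    moreover have "(v, v) \<in> ?T" using r(1) that by (auto simp: order_on_defs refl_on_def)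
    ultimately have "{w \<in> pts P. (w, u) \<in> ?T} \<subset> {w \<in> pts P. (w, v) \<in> ?T}"
      using plane_total_order_trans[OF P _ that(4)] that(2) by blast
    then show ?thesis unfolding rank_def using fin by (simp add: psubset_card_mono)
  qed
  have sx: "\<sigma> x \<in> pts P" using b x by (rule bij_betw_apply)
  have "{v \<in> pts P. (v, \<sigma> x) \<in> ?T} = \<sigma> ` {v \<in> pts P. (v, x) \<in> ?T}"
  proof (intro equalityI subsetI)
    fix w assume w: "w \<in> {v \<in> pts P. (v, \<sigma> x) \<in> ?T}"
    then obtain v where "v \<in> pts P" "w = \<sigma> v" using b by (auto simp: bij_betw_def)
    then show "w \<in> \<sigma> ` {v \<in> pts P. (v, x) \<in> ?T}" using w pres[OF _ x] by auto
  next
    fix w assume "w \<in> \<sigma> ` {v \<in> pts P. (v, x) \<in> ?T}"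
    then obtain v where v: "v \<in> pts P" "(v, x) \<in> ?T" "w = \<sigma> v" by blast
    then show "w \<in> {v \<in> pts P. (v, \<sigma> x) \<in> ?T}"
      using pres[OF v(1) x] bij_betw_apply[OF b v(1)] by simp
  qed
  moreover have "inj_on \<sigma> {v \<in> pts P. (v, x) \<in> ?T}"
    using b by (auto simp: bij_betw_def inj_on_def)
  ultimately have "rank (\<sigma> x) = rank x" unfolding rank_def by (simp add: card_image)
  moreover have "(\<sigma> x, x) \<in> ?T \<or> (x, \<sigma> x) \<in> ?T" if "\<sigma> x \<noteq> x"
    using P sx x that unfolding is_plane_def comparable_def by blast
  ultimately show ?thesis
    using rank_less[OF sx x] rank_less[OF x sx] by (metis less_irrefl)
qed

lemma card_S_swap_orders_plane:
  assumes "is_plane P"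
  shows "card (S P (swap_orders P)) = 1"
proof -
  have "\<sigma> = restrict id (pts P)" if "\<sigma> \<in> S P (swap_orders P)" for \<sigma>
  proof (rule extensionalityI)
    show "\<sigma> \<in> extensional (pts P)" using that by (simp add: S_def)
  qed (simp_all add: plane_automorphism_trivial[OF assms that])
  with dposet_iso_imp_S_swap_orders[OF dposet_iso_refl[of P]]
  have "S P (swap_orders P) = {restrict id (pts P)}" by blast
  then show ?thesis by simp
qed

section \<open>Antichains\<close>

definition antichain :: "nat \<Rightarrow> nat double_poset" where
  "antichain n = \<lparr>pts = {..<n}, le1 = Id_on {..<n}, le2 = Id_on {..<n}\<rparr>"

lemma is_dposet_antichain: "is_dposet (antichain n)"
  by (auto simp: is_dposet_def antichain_def order_on_defs refl_on_def trans_def antisym_def)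

lemma card_extensional_bij_betw:
  assumes "finite A" "finite B" "card A = card B"
  shows "card {f \<in> extensional A. bij_betw f A B} = fact (card A)"
proof -
  have "f ` A = B" if "f ` A \<subseteq> B" "inj_on f A" for f
    using that assms by (metis card_image card_subset_eq)
  then have "{f \<in> extensional A. bij_betw f A B} = {f \<in> A \<rightarrow>\<^sub>E B. inj_on f A}"
    by (auto simp: PiE_def bij_betw_def)
  then show ?thesis
    using card_inj_on_subset_funcset[OF assms(1,2) order_refl] assms(3)
    by (simp add: fact_prod_rev)
qed

text \<open>
  A single element of \<open>S\<close> forces the first order of \<open>Q\<close> to be trivial, and then every bijection
  belongs to \<open>S\<close>.
\<close>

lemma fact_dvd_card_S_antichain:
  assumes Q: "is_dposet Q"
  shows "fact n dvd card (S (antichain n) Q)"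
proof (cases "S (antichain n) Q = {}")
  case False
  then obtain \<tau> where t: "\<tau> \<in> S (antichain n) Q" by blast
  then have bt: "bij_betw \<tau> {..<n} (pts Q)" by (simp add: S_def antichain_def)
  have triv: "x = y" if xy: "(x, y) \<in> le1 Q" for x y
  proof -
    have "x \<in> \<tau> ` {..<n}" "y \<in> \<tau> ` {..<n}"
      using xy is_dposetD(2)[OF Q] bt by (auto simp: bij_betw_def)
    then show ?thesis using t xy by (auto simp: S_def antichain_def)
  qed
  have refl: "(x, x) \<in> le2 Q" if "x \<in> pts Q" for x
    using Q that by (auto simp: is_dposet_def order_on_defs refl_on_def)
  have "S (antichain n) Q = {f \<in> extensional {..<n}. bij_betw f {..<n} (pts Q)}"
    using triv refl by (fastforce simp: S_def antichain_def bij_betw_def dest: inj_onD)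
  then show ?thesis
    using card_extensional_bij_betw[of "{..<n}" "pts Q"] bij_betw_same_card[OF bt]
      is_dposetD(1)[OF Q] by simp
qed simp

section \<open>Isomorphism classes and the pairing\<close>

lift_definition swap_class :: "dpclass \<Rightarrow> dpclass" is swap_orders
  using is_dposet_swap_orders dposet_iso_swap_orders by blast

lift_definition class_excess :: "dpclass \<Rightarrow> int" is order_excess
  using order_excess_iso by blast

lift_definition antichain_class :: "nat \<Rightarrow> dpclass" is antichain
  using is_dposet_antichain dposet_iso_refl by blast

lemma plane_swap_class: "plane_class p \<Longrightarrow> plane_class (swap_class p)"
  by transfer (use is_plane_swap_orders in blast)

lemma WN_swap_class: "WN_class p \<Longrightarrow> WN_class (swap_class p)"
  by transfer (use is_WN_swap_orders in blast)

lemma WN_imp_plane_class: "WN_class p \<Longrightarrow> plane_class p"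
  by transfer (simp add: is_WN_def)

lemma card_S_swap_class_self_neq_0: "card_S p (swap_class p) \<noteq> 0"
  by transfer (use card_S_swap_orders_self_pos in force)

lemma card_S_swap_class_plane: "plane_class p \<Longrightarrow> card_S p (swap_class p) = 1"
  by transfer (use card_S_swap_orders_plane in blast)

lemma card_S_swap_class_triangular:
  "card_S p (swap_class q) \<noteq> 0 \<Longrightarrow> p = q \<or> class_excess p < class_excess q"
  by transfer (metis S_swap_orders_iso_or_excess_less card.empty)

lemma fact_dvd_card_S_antichain_class: "fact n dvd card_S (antichain_class n) q"
  by transfer (use fact_dvd_card_S_antichain in blast)

text \<open>
  If \<open>p\<close> has least excess in the support of \<open>x\<close>, triangularity leaves only the term of \<open>p\<close> in the
  pairing of \<open>x\<close> with the swap of \<open>p\<close>, so a nonzero diagonal entry suffices.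
\<close>

lemma nondegenerate_on_H:
  assumes closed: "\<And>p. p \<in> B \<Longrightarrow> swap_class p \<in> B"
    and diag: "\<And>p. p \<in> B \<Longrightarrow> (of_nat (card_S p (swap_class p)) :: 'k::field) \<noteq> 0"
  shows "nondegenerate_on (H B :: (dpclass \<Rightarrow>\<^sub>0 'k) set) pairing"
  unfolding nondegenerate_on_def
proof (intro ballI impI)
  fix x :: "dpclass \<Rightarrow>\<^sub>0 'k"
  assume x: "x \<in> H B" and orth: "\<forall>y\<in>H B. pairing x y = 0"
  show "x = 0"
  proof (rule ccontr)
    assume "x \<noteq> 0"
    let ?K = "Poly_Mapping.keys x"
    have ne: "?K \<noteq> {}" using \<open>x \<noteq> 0\<close> by simp
    obtain p where p: "p \<in> ?K" and min: "\<And>q. q \<in> ?K \<Longrightarrow> class_excess p \<le> class_excess q"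
      using ex_min_if_finite[of "class_excess ` ?K"] ne by (force simp: not_less)
    have pB: "p \<in> B" using p x by (auto simp: H_def)
    have "card_S q (swap_class p) = 0" if "q \<in> ?K" "q \<noteq> p" for q
      using card_S_swap_class_triangular[of q p] min[OF that(1)] that(2) by force
    then have "pairing x (Poly_Mapping.single (swap_class p) 1)
        = (\<Sum>q\<in>?K. if q = p then Poly_Mapping.lookup x p * of_nat (card_S p (swap_class p)) else 0)"
      unfolding pairing_def by (intro sum.cong) auto
    also have "\<dots> = Poly_Mapping.lookup x p * of_nat (card_S p (swap_class p))"
      using p by simp
    also have "\<dots> \<noteq> 0" using p diag[OF pB] by (simp add: in_keys_iff)
    finally show False
      using orth closed[OF pB] by (auto simp: H_def)
  qed
qed

lemma degenerate_on_H_DP: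
  assumes "CHAR('k::field) \<noteq> 0"
  shows "\<not> nondegenerate_on (H DP :: (dpclass \<Rightarrow>\<^sub>0 'k) set) pairing"
proof -
  let ?x = "Poly_Mapping.single (antichain_class CHAR('k)) (1 :: 'k)"
  have "(of_nat (card_S (antichain_class CHAR('k)) q) :: 'k) = 0" for q
    using dvd_trans[OF dvd_fact fact_dvd_card_S_antichain_class, of "CHAR('k)" "CHAR('k)" q] assms
    by (simp add: of_nat_eq_0_iff_char_dvd)
  then have "pairing ?x y = 0" for y by (simp add: pairing_def)
  moreover have "?x \<noteq> 0" by (metis lookup_single_eq lookup_zero one_neq_zero)
  ultimately show ?thesis
    unfolding nondegenerate_on_def by (auto simp: H_def DP_def)
qed

theorem theorem36:
  shows "(nondegenerate_on (H DP :: (dpclass \<Rightarrow>\<^sub>0 'k::field) set) pairing \<longleftrightarrow> CHAR('k) = 0) \<and>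
    nondegenerate_on (H PP :: (dpclass \<Rightarrow>\<^sub>0 'k) set) pairing \<and>
    nondegenerate_on (H WNP :: (dpclass \<Rightarrow>\<^sub>0 'k) set) pairing"
proof (intro conjI iffI)
  assume "CHAR('k) = 0"
  then show "nondegenerate_on (H DP :: (dpclass \<Rightarrow>\<^sub>0 'k) set) pairing"
    by (intro nondegenerate_on_H)
      (simp_all add: DP_def of_nat_eq_0_iff_char_dvd card_S_swap_class_self_neq_0)
next
  show "CHAR('k) = 0" if "nondegenerate_on (H DP :: (dpclass \<Rightarrow>\<^sub>0 'k) set) pairing"
    using that degenerate_on_H_DP by blast
next
  show "nondegenerate_on (H PP :: (dpclass \<Rightarrow>\<^sub>0 'k) set) pairing"
    by (rule nondegenerate_on_H) (simp_all add: PP_def plane_swap_class card_S_swap_class_plane)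
next
  show "nondegenerate_on (H WNP :: (dpclass \<Rightarrow>\<^sub>0 'k) set) pairing"
    by (rule nondegenerate_on_H)
      (simp_all add: WNP_def WN_swap_class card_S_swap_class_plane WN_imp_plane_class)
qed

end
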